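(* Let $m\ge3$ be odd, let $c=2^{-1}\bmod m=(m+1)/2$, and let $\tau^{(n)}$ be as defined in the context. For every $n\ge1$ and $(v_1,\dots,v_n)\in\{0,\dots,m-1\}^n$, the $n$-th coordinate $t_n$ of $\tau^{(n)}(v_1,\dots,v_n)$ is $$t_n=\Bigl(2^{-(n-1)}v_n+\sum_{i=1}^{n-1}2^{-i}v_i\Bigr)\bmod m,$$ where $2^{-k}$ denotes the inverse of $2^k$ modulo $m$; so $t_n\equiv 2^{-(n-1)}\widetilde{\widetilde v}_n\pmod m$ with $\widetilde{\widetilde v}_n=v_n+\sum_{i=1}^{n-1}2^{n-1-i}v_i$.
   Context: Fix an odd $m\ge3$ and $c=2^{-1}\bmod m$. Define maps $\tau^{(n)}:\{0,\dots,m-1\}^n\to\{0,\dots,m-1\}^n$ recursively: $\tau^{(1)}$ is the identity, and for $n\ge2$, $\tau^{(n)}(v_1,\dots,v_n)=\bigl(v_1,\ \tau^{(n-1)}(c(v_1+v_2)\bmod m,\dots,c(v_1+v_n)\bmod m)\bigr)$. *)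

theory Defs
  imports "HOL-Number_Theory.Number_Theory"
begin

text \<open>
  A vector \<open>(v\<^sub>1, \<dots>, v\<^sub>n) \<in> {0, \<dots>, m - 1}\<^sup>n\<close> is an integer list of length \<open>n\<close>; the paper's
  coordinate \<open>v\<^sub>i\<close> is \<open>v ! (i - 1)\<close>.
\<close>

definition residue_vectors :: "int \<Rightarrow> nat \<Rightarrow> int list set" where
  "residue_vectors m n = {v. length v = n \<and> set v \<subseteq> {0..m - 1}}"

text \<open>The value at \<open>n = 0\<close> is a dummy.\<close>

fun tau :: "int \<Rightarrow> int \<Rightarrow> nat \<Rightarrow> int list \<Rightarrow> int list" where
  "tau m c 0 v = v"
| "tau m c (Suc 0) v = v"
| "tau m c (Suc (Suc k)) v =
     hd v # tau m c (Suc k) (map (\<lambda>w. (c * (hd v + w)) mod m) (tl v))"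

lemma tau_in_residue_vectors:
  assumes "m > 0" and "v \<in> residue_vectors m n"
  shows "tau m c n v \<in> residue_vectors m n"
  using assms
proof (induction m c n v rule: tau.induct)
  case (3 m c k v)
  then obtain x xs where v: "v = x # xs" "length xs = Suc k"
    by (cases v) (auto simp: residue_vectors_def)
  have "map (\<lambda>w. (c * (hd v + w)) mod m) (tl v) \<in> residue_vectors m (Suc k)"
    using 3 v by (auto simp: residue_vectors_def)
  with 3 v show ?case
    by (auto simp: residue_vectors_def)
qed auto

end

theory Submission
  imports Defs
begin

text \<open>
  Modulo \<open>m\<close> every inverse of \<open>2 ^ k\<close> is \<open>c ^ k\<close>. Unfolding the recursion once, the weights
  \<open>c ^ k\<close> and \<open>c ^ i\<close> (for \<open>i = 1, \<dots>, k\<close>) of the remaining coordinates are multiplied by \<open>c\<close>, while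
  \<open>v\<^sub>1\<close> collects \<open>c\<close> times their sum; since \<open>2 c \<equiv> 1\<close>, those weights add up to \<open>1\<close>.
\<close>

lemma cong_sum_powers_half:
  fixes m c :: int
  assumes "[2 * c = 1] (mod m)"
  shows "[c ^ k + (\<Sum>i<k. c ^ Suc i) = 1] (mod m)"
proof (induction k)
  case (Suc k)
  \<comment> \<open>For \<open>Suc k\<close>, the leading power and the last summand are both
    \<open>c ^ Suc k\<close>; together they make \<open>2 * c * c ^ k\<close>, which is congruent to
    \<open>c ^ k\<close>.\<close>
  have "[2 * c * c ^ k + (\<Sum>i<k. c ^ Suc i) = 1 * c ^ k + (\<Sum>i<k. c ^ Suc i)] (mod m)"
    by (intro cong_add cong_mult assms cong_refl)
  with Suc.IH have "[2 * c * c ^ k + (\<Sum>i<k. c ^ Suc i) = 1] (mod m)"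
    by (auto intro: cong_trans)
  then show ?case
    by (simp add: algebra_simps)
qed simp

text \<open>Powers of \<open>c\<close> stand in for the inverses of powers of \<open>2\<close>: the
  recursion multiplies each weight by \<open>c\<close>, so the formula keeps its shape through the
  induction.\<close>

lemma tau_last_cong:
  fixes m c :: int
  assumes "[2 * c = 1] (mod m)" and "length v = Suc k"
  shows "[tau m c (Suc k) v ! k = c ^ k * v ! k + (\<Sum>i<k. c ^ Suc i * v ! i)] (mod m)"
  using assms(2)
proof (induction k arbitrary: v)
  case (Suc k)
  then obtain x xs where v: "v = x # xs" and len: "length xs = Suc k"
    by (cases v) auto
  define w where "w = map (\<lambda>y. (c * (x + y)) mod m) xs"
  have w: "[w ! i = c * (x + xs ! i)] (mod m)" if "i < Suc k" for i
    using that len by (simp add: w_def cong_def)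
  have "[tau m c (Suc k) w ! k = c ^ k * w ! k + (\<Sum>i<k. c ^ Suc i * w ! i)] (mod m)"
    using len by (intro Suc.IH) (simp add: w_def)
  also have "[c ^ k * w ! k + (\<Sum>i<k. c ^ Suc i * w ! i)
      = c ^ k * (c * (x + xs ! k)) + (\<Sum>i<k. c ^ Suc i * (c * (x + xs ! i)))] (mod m)"
    by (intro cong_add cong_mult cong_sum cong_refl w) auto
  also have "c ^ k * (c * (x + xs ! k)) + (\<Sum>i<k. c ^ Suc i * (c * (x + xs ! i)))
      = c * x * (c ^ k + (\<Sum>i<k. c ^ Suc i))
        + (c ^ Suc k * xs ! k + (\<Sum>i<k. c ^ Suc (Suc i) * xs ! i))"
    by (simp add: algebra_simps sum.distrib sum_distrib_left)
  also have "[\<dots> = c * x * 1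
        + (c ^ Suc k * xs ! k + (\<Sum>i<k. c ^ Suc (Suc i) * xs ! i))] (mod m)"
    by (intro cong_add cong_mult cong_refl cong_sum_powers_half assms(1))
  \<comment> \<open>Splitting off the summand at index \<open>0\<close> gives the head's
    contribution \<open>c * x\<close>; the other summands are those of \<open>xs\<close> with the
    index shifted by one.\<close>
  finally show ?case
    unfolding sum.lessThan_Suc_shift by (simp add: v w_def algebra_simps)
qed simp

text \<open>Both sides are inverses of \<open>a ^ k\<close>, a factor that is coprime to
  \<open>m\<close> and hence cancels. Equality may fail, since a power of a reduced residue need not
  be reduced.\<close>

lemma modular_inverse_power_cong:
  fixes m a :: int
  assumes "coprime a m"
  shows "[modular_inverse m (a ^ k) = modular_inverse m a ^ k] (mod m)"
proof -
  have "[a ^ k * modular_inverse m (a ^ k) = 1] (mod m)"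
    using assms by (intro cong_modular_inverse1) simp
  moreover have "[(a * modular_inverse m a) ^ k = 1 ^ k] (mod m)"
    using assms by (intro cong_pow cong_modular_inverse1)
  ultimately have "[a ^ k * modular_inverse m (a ^ k) = a ^ k * modular_inverse m a ^ k] (mod m)"
    by (metis cong_sym cong_trans power_mult_distrib power_one)
  then show ?thesis
    using assms by (simp add: cong_mult_lcancel)
qed

lemma modular_inverse_2_odd:
  fixes m :: int
  assumes "m \<ge> 3" and "odd m"
  shows "modular_inverse m 2 = (m + 1) div 2"
proof (rule modular_inverse_int_eqI)
  show "(m + 1) div 2 \<in> {0..<m}"
    using assms(1) by auto
  have "2 * ((m + 1) div 2) = m + 1"
    using assms(2) by presburger
  then show "[2 * ((m + 1) div 2) = 1] (mod m)"
    by (simp add: cong_def)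
qed

theorem theorem8:
  fixes m c :: int and n :: nat and v :: "int list"
  assumes "m \<ge> 3" and "odd m"
    and "c = modular_inverse m 2"
    and "n \<ge> 1" and "v \<in> residue_vectors m n"
  shows "c = (m + 1) div 2
    \<and> tau m c n v ! (n - 1) =
        (modular_inverse m (2 ^ (n - 1)) * v ! (n - 1)
          + (\<Sum>i=1..n - 1. modular_inverse m (2 ^ i) * v ! (i - 1))) mod m
    \<and> [tau m c n v ! (n - 1) =
         modular_inverse m (2 ^ (n - 1)) *
           (v ! (n - 1) + (\<Sum>i=1..n - 1. 2 ^ (n - 1 - i) * v ! (i - 1)))] (mod m)"
proof -
  obtain k where n: "n = Suc k"
    using assms(4) by (cases n) auto
  have cop: "coprime 2 m"
    using assms(2) by simp
  have c2: "[2 * c = 1] (mod m)"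
    unfolding assms(3) using cop by (rule cong_modular_inverse1)
  have inv: "[modular_inverse m (2 ^ i) = c ^ i] (mod m)" for i
    unfolding assms(3) using cop by (rule modular_inverse_power_cong)
  have len: "length v = Suc k"
    using assms(5) n by (simp add: residue_vectors_def)
  let ?t = "tau m c (Suc k) v ! k"
  have t: "[?t = c ^ k * v ! k + (\<Sum>i=1..k. c ^ i * v ! (i - 1))] (mod m)"
    using tau_last_cong[OF c2 len] by (simp add: sum.atLeast1_atMost_eq)
  \<comment> \<open>The coordinate lies in \<open>{0..m - 1}\<close> and so is its own remainder;
    this turns the congruence into the claimed equation.\<close>
  have "tau m c (Suc k) v \<in> residue_vectors m (Suc k)"
    using assms(1,5) n by (intro tau_in_residue_vectors) auto
  then have "?t \<in> {0..m - 1}"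
    unfolding residue_vectors_def by (metis (mono_tags, lifting) lessI mem_Collect_eq nth_mem subsetD)
  then have t_mod: "?t mod m = ?t"
    by simp
  have "[c ^ k * v ! k + (\<Sum>i=1..k. c ^ i * v ! (i - 1))
      = modular_inverse m (2 ^ k) * v ! k
        + (\<Sum>i=1..k. modular_inverse m (2 ^ i) * v ! (i - 1))] (mod m)"
    by (intro cong_add cong_mult cong_sum cong_refl cong_sym[OF inv])
  with t have "?t mod m = (modular_inverse m (2 ^ k) * v ! k
        + (\<Sum>i=1..k. modular_inverse m (2 ^ i) * v ! (i - 1))) mod m"
    unfolding cong_def by simp
  moreover have "[?t = modular_inverse m (2 ^ k) *
      (v ! k + (\<Sum>i=1..k. 2 ^ (k - i) * v ! (i - 1)))] (mod m)"
  proof -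
    \<comment> \<open>Multiplying \<open>c ^ i\<close> by \<open>k - i\<close> factors
      \<open>2 * c\<close>, each congruent to \<open>1\<close>, exposes the factor
      \<open>c ^ k\<close> common to all summands.\<close>
    have pow: "[c ^ i = c ^ k * 2 ^ (k - i)] (mod m)" if "i \<le> k" for i
    proof -
      have "[c ^ i * (2 * c) ^ (k - i) = c ^ i * 1 ^ (k - i)] (mod m)"
        by (intro cong_mult cong_pow cong_refl c2)
      moreover have "c ^ i * (2 * c) ^ (k - i) = c ^ k * 2 ^ (k - i)"
        using that by (simp add: power_mult_distrib flip: power_add)
      ultimately show ?thesis
        by (metis cong_sym mult_1_right power_one)
    qed
    have "[c ^ k * v ! k + (\<Sum>i=1..k. c ^ i * v ! (i - 1))
        = c ^ k * v ! k + (\<Sum>i=1..k. c ^ k * 2 ^ (k - i) * v ! (i - 1))] (mod m)"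
      by (intro cong_add cong_mult cong_sum cong_refl pow) auto
    also have "c ^ k * v ! k + (\<Sum>i=1..k. c ^ k * 2 ^ (k - i) * v ! (i - 1))
        = c ^ k * (v ! k + (\<Sum>i=1..k. 2 ^ (k - i) * v ! (i - 1)))"
      by (simp add: distrib_left sum_distrib_left mult.assoc)
    also have "[\<dots> = modular_inverse m (2 ^ k) *
        (v ! k + (\<Sum>i=1..k. 2 ^ (k - i) * v ! (i - 1)))] (mod m)"
      by (intro cong_mult cong_refl cong_sym[OF inv])
    finally show ?thesis
      using t cong_trans by blast
  qed
  ultimately show ?thesis
    using modular_inverse_2_odd[OF assms(1,2)] assms(3) t_mod n by simp
qed

end
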